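(* Let $t\in\mathbb{N}$ and let $a_j,b_j\in\mathbb{N}_0$ and integers $c_j\ge3$ for all $j\ge1$. Then for every $n\in\mathbb{N}$: (i) If $r\in\mathbb{N}$ and $\mathbf{s}=(\{2\}^{b_1},c_1,\{2\}^{a_1},1,\dots,\{2\}^{b_r},c_r,\{2\}^{a_r},1,\{2\}^t)$, then \[H^\star_n(\mathbf{s})=-\sum_{\mathbf{p}\in\Pi(\overline{2b_1+2},\{1\}^{c_1-3},\overline{2a_1+2},\,\dots,\,\overline{2b_r+2},\{1\}^{c_r-3},\overline{2a_r+2},\overline{2t})}2^{\ell(\mathbf{p})}\mathcal{H}_n(\mathbf{p}).\] (ii) If $r\ge0$, $a_0\in\mathbb{N}_0$ and $\mathbf{s}=(\{2\}^{a_0},1,\{2\}^{b_1},c_1,\{2\}^{a_1},1,\dots,\{2\}^{b_r},c_r,\{2\}^{a_r},1,\{2\}^t)$, then \[H^\star_n(\mathbf{s})=-\sum_{\mathbf{p}\in\Pi(2a_0+1,\overline{2b_1+2},\{1\}^{c_1-3},\overline{2a_1+2},\,\dots,\,\overline{2b_r+2},\{1\}^{c_r-3},\overline{2a_r+2},\overline{2t})}2^{\ell(\mathbf{p})}\mathcal{H}_n(\mathbf{p}).\]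
   Context: $\mathbb{N}=\{1,2,\dots\}$, $\mathbb{N}_0=\mathbb{N}\cup\{0\}$; for a positive integer $m$, $\overline{m}$ denotes $-m$. $\{x\}^a$ denotes $a$ consecutive copies of $x$. For $\mathbf{s}=(s_1,\dots,s_\ell)$ with nonzero integer entries, $H_n(\mathbf{s})=\sum_{n\ge k_1>\cdots>k_\ell\ge1}\prod_{i=1}^\ell \frac{\operatorname{sgn}(s_i)^{k_i}}{k_i^{|s_i|}}$ and $H^\star_n(\mathbf{s})=\sum_{n\ge k_1\ge\cdots\ge k_\ell\ge1}\prod_{i=1}^\ell \frac{\operatorname{sgn}(s_i)^{k_i}}{k_i^{|s_i|}}$, with $H_n(\mathbf{s})=0$ if $n<\ell$ and $H_n(\emptyset)=H^\star_n(\emptyset)=1$. For nonzero integers $a,b$, $a\oplus b=\operatorname{sgn}(a)b+\operatorname{sgn}(b)a$. For a sequence $(s_1,\dots,s_m)$ of nonzero integers, $\Pi(s_1,\dots,s_m)$ is the set of the $2^{m-1}$ indices $s_1\circ\cdots\circ s_m$ where each $\circ$ is independently "," or $\oplus$ (entries joined by $\oplus$ merge into one component); $\ell(\mathbf{p})$ is the number of components. For $\mathbf{p}=(p_1,\dots,p_m)$, $\mathcal{H}_n(\mathbf{p})=\sum_{k=1}^n\frac{\operatorname{sgn}(p_1)^k}{k^{|p_1|}}\frac{\binom{n}{k}}{\binom{n+k}{k}}H_{k-1}(p_2,\dots,p_m)$. *)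

theory Defs
  imports Complex_Main
begin

definition hweight :: "int list \<Rightarrow> nat list \<Rightarrow> real" where
  "hweight s k = (\<Prod>i<length s. real_of_int (sgn (s ! i)) ^ (k ! i) / real (k ! i) ^ nat \<bar>s ! i\<bar>)"

definition mhs :: "nat \<Rightarrow> int list \<Rightarrow> real" where
  "mhs n s = (\<Sum>k | length k = length s \<and> set k \<subseteq> {1..n} \<and> sorted_wrt (>) k. hweight s k)"

definition mhs_star :: "nat \<Rightarrow> int list \<Rightarrow> real" where
  "mhs_star n s = (\<Sum>k | length k = length s \<and> set k \<subseteq> {1..n} \<and> sorted_wrt (\<ge>) k. hweight s k)"

definition oplus :: "int \<Rightarrow> int \<Rightarrow> int"  (infixl "\<oplus>" 65) where
  "x \<oplus> y = sgn x * y + sgn y * x"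

text \<open>
  The set of all indices \<open>s\<^sub>1 \<circ> \<dots> \<circ> s\<^sub>m\<close>, each \<open>\<circ>\<close> being a comma or \<open>\<oplus>\<close>. The last equation
  branches on the leftmost \<open>\<circ>\<close>; bracketing runs of \<open>\<oplus>\<close> to the left is harmless since \<open>\<oplus>\<close>
  is associative (it multiplies signs and adds absolute values) on nonzero integers.
\<close>

fun Pi_indices :: "int list \<Rightarrow> int list set" where
  "Pi_indices [] = {[]}"
| "Pi_indices [x] = {[x]}"
| "Pi_indices (x # y # s) = (#) x ` Pi_indices (y # s) \<union> Pi_indices ((x \<oplus> y) # s)"

text \<open>Only meaningful for a nonempty index \<open>p\<close>.\<close>

definition mhs_binom :: "nat \<Rightarrow> int list \<Rightarrow> real" where
  "mhs_binom n p = (\<Sum>k=1..n. real_of_int (sgn (hd p)) ^ k / real k ^ nat \<bar>hd p\<bar>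
     * (real (n choose k) / real ((n + k) choose k)) * mhs (k - 1) (tl p))"

text \<open>
  The families of entries repeated for \<open>j = 1, \<dots>, r\<close>: \<open>{2}\<^bsup>b\<^sub>j\<^esup>, c\<^sub>j, {2}\<^bsup>a\<^sub>j\<^esup>, 1\<close> on the left-hand
  side, and \<open>-(2b\<^sub>j+2), {1}\<^bsup>c\<^sub>j-3\<^esup>, -(2a\<^sub>j+2)\<close> in the argument of \<open>Pi_indices\<close>.
\<close>

definition star_blocks :: "(nat \<Rightarrow> nat) \<Rightarrow> (nat \<Rightarrow> nat) \<Rightarrow> (nat \<Rightarrow> int) \<Rightarrow> nat \<Rightarrow> int list" where
  "star_blocks a b c r =
     concat (map (\<lambda>j. replicate (b j) 2 @ [c j] @ replicate (a j) 2 @ [1]) [1..<Suc r])"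

definition Pi_blocks :: "(nat \<Rightarrow> nat) \<Rightarrow> (nat \<Rightarrow> nat) \<Rightarrow> (nat \<Rightarrow> int) \<Rightarrow> nat \<Rightarrow> int list" where
  "Pi_blocks a b c r =
     concat (map (\<lambda>j. [- int (2 * b j + 2)] @ replicate (nat (c j - 3)) 1 @ [- int (2 * a j + 2)])
       [1..<Suc r])"

end

theory Submission
  imports Defs
begin

text \<open>
  Write \<open>A n k = binom n k / binom (n + k) k\<close>. Summing \<open>2\<^bsup>l(p)\<^esup> \<H>\<^sub>n(p)\<close> over \<open>\<Pi>(q\<^sub>1,\<dots>,q\<^sub>m)\<close> amounts to
  summing \<open>A n k\<^sub>1 \<Prod> sgn(q\<^sub>i)\<^bsup>k\<^sub>i\<^esup> / k\<^sub>i\<^bsup>|q\<^sub>i|\<^esup>\<close> over \<open>n \<ge> k\<^sub>1 \<ge> \<dots> \<ge> k\<^sub>m \<ge> 1\<close>, each term weighted by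
  \<open>2\<close> to the number of distinct \<open>k\<^sub>i\<close>. The leading entry of the star sum is stripped by
  differencing in \<open>n\<close>, and \<open>A n k - A (n-1) k = k\<^sup>2/n\<^sup>2 A n k\<close> lowers the exponent of \<open>k\<^sub>1\<close> by two.
  This settles a leading \<open>2\<close>; for a leading \<open>1\<close> or \<open>c \<ge> 3\<close> the exponent of \<open>k\<^sub>1\<close> becomes \<open>-1\<close> or
  \<open>0\<close> (with alternating sign), and the sum over \<open>k\<^sub>1\<close> telescopes:
  \<open>j A n j + 2 \<Sum>\<^bsub>k>j\<^esub> k A n k = n A n j\<close> and
  \<open>(-1)\<^sup>j A n j + 2 \<Sum>\<^bsub>k>j\<^esub> (-1)\<^sup>k A n k = (-1)\<^sup>j j/n A n j\<close>.
\<close>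

definition term_weight :: "int \<Rightarrow> nat \<Rightarrow> real" where
  "term_weight x k = real_of_int (sgn x) ^ k / real k ^ nat \<bar>x\<bar>"

definition binom_quot :: "nat \<Rightarrow> nat \<Rightarrow> real" where
  "binom_quot n k = real (n choose k) / real ((n + k) choose k)"

text \<open>
  The sum over weakly decreasing chains starting at \<open>k\<close>, weighted by \<open>2\<close> to the number of distinct
  members. Arbitrary weight functions are allowed because \<open>(-1)\<^sup>k k\<^sup>0\<close> is not of the form
  \<open>term_weight x\<close>.
\<close>

fun chain_sum :: "(nat \<Rightarrow> real) list \<Rightarrow> nat \<Rightarrow> real" where
  "chain_sum [] k = 0"
| "chain_sum [f] k = 2 * f k"
| "chain_sum (f # g # fs) k =
     f k * (chain_sum (g # fs) k + 2 * (\<Sum>j\<in>{1..<k}. chain_sum (g # fs) j))"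

definition binom_chain_sum :: "nat \<Rightarrow> (nat \<Rightarrow> real) list \<Rightarrow> real" where
  "binom_chain_sum n fs = (\<Sum>k=1..n. binom_quot n k * chain_sum fs k)"

subsection \<open>Recursions for multiple harmonic sums\<close>

lemma hweight_Cons: "hweight (x # s) (j # k) = term_weight x j * hweight s k"
  by (simp add: hweight_def term_weight_def prod.lessThan_Suc_shift del: prod.lessThan_Suc)

lemma finite_index_lists: "finite {k. length k = l \<and> set k \<subseteq> {1..n::nat} \<and> P k}"
  by (rule finite_subset[OF _ finite_lists_length_eq[of "{1..n}" l]]) auto

lemma mhs_Nil [simp]: "mhs n [] = 1"
  by (simp add: mhs_def hweight_def cong: conj_cong)

lemma mhs_star_Nil [simp]: "mhs_star n [] = 1"
  by (simp add: mhs_star_def hweight_def cong: conj_cong)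

lemma mhs_Cons: "mhs n (x # s) = (\<Sum>j=1..n. term_weight x j * mhs (j - 1) s)"
proof -
  let ?K = "\<lambda>m. {k. length k = length s \<and> set k \<subseteq> {1..m} \<and> sorted_wrt (>) k}"
  have eq: "{k. length k = length (x # s) \<and> set k \<subseteq> {1..n} \<and> sorted_wrt (>) k}
      = (\<lambda>(j, k). j # k) ` (SIGMA j:{1..n}. ?K (j - 1))"
  proof (intro equalityI subsetI)
    fix k assume k: "k \<in> {k. length k = length (x # s) \<and> set k \<subseteq> {1..n} \<and> sorted_wrt (>) k}"
    then obtain j k' where "k = j # k'" by (cases k) auto
    with k have "(j, k') \<in> (SIGMA j:{1..n}. ?K (j - 1))" by fastforce
    with \<open>k = j # k'\<close> show "k \<in> (\<lambda>(j, k). j # k) ` (SIGMA j:{1..n}. ?K (j - 1))"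
      by force
  qed fastforce
  have "mhs n (x # s) = (\<Sum>(j, k)\<in>(SIGMA j:{1..n}. ?K (j - 1)). hweight (x # s) (j # k))"
    unfolding mhs_def eq by (subst sum.reindex) (auto simp: inj_on_def case_prod_beta)
  also have "\<dots> = (\<Sum>j=1..n. \<Sum>k\<in>?K (j - 1). hweight (x # s) (j # k))"
    by (rule sum.Sigma [symmetric]) (use finite_index_lists in auto)
  finally show ?thesis
    by (simp add: hweight_Cons mhs_def sum_distrib_left)
qed

lemma mhs_star_Cons: "mhs_star n (x # s) = (\<Sum>j=1..n. term_weight x j * mhs_star j s)"
proof -
  let ?K = "\<lambda>m. {k. length k = length s \<and> set k \<subseteq> {1..m} \<and> sorted_wrt (\<ge>) k}"
  have eq: "{k. length k = length (x # s) \<and> set k \<subseteq> {1..n} \<and> sorted_wrt (\<ge>) k}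
      = (\<lambda>(j, k). j # k) ` (SIGMA j:{1..n}. ?K j)"
  proof (intro equalityI subsetI)
    fix k assume k: "k \<in> {k. length k = length (x # s) \<and> set k \<subseteq> {1..n} \<and> sorted_wrt (\<ge>) k}"
    then obtain j k' where "k = j # k'" by (cases k) auto
    with k have "(j, k') \<in> (SIGMA j:{1..n}. ?K j)" by fastforce
    with \<open>k = j # k'\<close> show "k \<in> (\<lambda>(j, k). j # k) ` (SIGMA j:{1..n}. ?K j)"
      by force
  qed fastforce
  have "mhs_star n (x # s) = (\<Sum>(j, k)\<in>(SIGMA j:{1..n}. ?K j). hweight (x # s) (j # k))"
    unfolding mhs_star_def eq by (subst sum.reindex) (auto simp: inj_on_def case_prod_beta)
  also have "\<dots> = (\<Sum>j=1..n. \<Sum>k\<in>?K j. hweight (x # s) (j # k))"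
    by (rule sum.Sigma [symmetric]) (use finite_index_lists in auto)
  finally show ?thesis
    by (simp add: hweight_Cons mhs_star_def sum_distrib_left)
qed

subsection \<open>Sums over \<open>Pi_indices\<close> as chain sums\<close>

lemma abs_oplus: "x \<noteq> 0 \<Longrightarrow> y \<noteq> 0 \<Longrightarrow> \<bar>x \<oplus> y\<bar> = \<bar>x\<bar> + \<bar>y\<bar>"
  by (auto simp: oplus_def sgn_if)

lemma sgn_oplus: "x \<noteq> 0 \<Longrightarrow> y \<noteq> 0 \<Longrightarrow> sgn (x \<oplus> y) = sgn x * sgn y"
  by (auto simp: oplus_def sgn_if)

text \<open>An \<open>\<oplus>\<close> encodes equality of neighbouring summation indices: both
  weights are then taken at the same \<open>k\<close>.\<close>

lemma term_weight_oplus: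
  assumes "x \<noteq> 0" "y \<noteq> 0"
  shows "term_weight (x \<oplus> y) k = term_weight x k * term_weight y k"
  using assms
  by (simp add: term_weight_def abs_oplus sgn_oplus nat_add_distrib power_add power_mult_distrib)

lemma finite_Pi_indices [simp]: "finite (Pi_indices q)"
  by (induction q rule: Pi_indices.induct) auto

text \<open>Merging strictly raises the absolute value of the head, so this bound separates the
  comma branch of \<open>Pi_indices\<close> from the \<open>\<oplus>\<close> branch.\<close>

lemma Pi_indices_hd:
  assumes "p \<in> Pi_indices (x # q)" "0 \<notin> set (x # q)"
  shows "p \<noteq> [] \<and> \<bar>x\<bar> \<le> \<bar>hd p\<bar>"
  using assms
proof (induction "x # q" arbitrary: x q p rule: Pi_indices.induct)
  case (3 x y s)
  have "x \<oplus> y \<noteq> 0" using abs_oplus[of x y] 3(4) by auto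
  then show ?case
    using 3 abs_oplus[of x y] by fastforce
qed auto

text \<open>A comma makes the next index strictly smaller and costs a factor 2; an
  \<open>\<oplus>\<close> keeps it equal. The two branches of \<open>Pi_indices\<close> thus yield
  the two summands in the recursion of \<open>chain_sum\<close>.\<close>

lemma sum_Pi_indices:
  assumes "q \<noteq> []" "0 \<notin> set q"
  shows "(\<Sum>p\<in>Pi_indices q. 2 ^ length p * (term_weight (hd p) k * mhs (k - 1) (tl p)))
       = chain_sum (map term_weight q) k"
  using assms
proof (induction q arbitrary: k rule: Pi_indices.induct)
  case (3 x y s)
  let ?g = "\<lambda>k p. 2 ^ length p * (term_weight (hd p) k * mhs (k - 1) (tl p)) :: real"
  have nz: "x \<oplus> y \<noteq> 0" and lt: "\<bar>x \<oplus> y\<bar> > \<bar>x\<bar>"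
    using abs_oplus[of x y] 3(4) by auto
  have disj: "(#) x ` Pi_indices (y # s) \<inter> Pi_indices ((x \<oplus> y) # s) = {}"
    using Pi_indices_hd[of _ "x \<oplus> y" s] nz lt 3(4) by fastforce
  have g_Cons: "?g k (x # p) = 2 * term_weight x k * (\<Sum>j\<in>{1..<k}. ?g j p)"
    if "p \<in> Pi_indices (y # s)" for p
  proof -
    have "p \<noteq> []" using Pi_indices_hd[OF that] 3(4) by auto
    then obtain z p' where p: "p = z # p'" by (cases p) auto
    have "{1..k - 1} = {1..<k}" by auto
    then show ?thesis
      by (simp add: p mhs_Cons sum_distrib_left mult_ac)
  qed
  have "(\<Sum>p\<in>(#) x ` Pi_indices (y # s). ?g k p)
      = 2 * term_weight x k * (\<Sum>p\<in>Pi_indices (y # s). \<Sum>j\<in>{1..<k}. ?g j p)"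
    by (subst sum.reindex) (auto simp only: o_def g_Cons sum_distrib_left inj_on_def cong: sum.cong)
  also have "\<dots> = 2 * term_weight x k * (\<Sum>j\<in>{1..<k}. chain_sum (map term_weight (y # s)) j)"
    using 3 by (subst sum.swap) simp
  finally have A: "(\<Sum>p\<in>(#) x ` Pi_indices (y # s). ?g k p) = \<dots>" .
  have "(\<Sum>p\<in>Pi_indices ((x \<oplus> y) # s). ?g k p) = chain_sum (map term_weight ((x \<oplus> y) # s)) k"
    using 3 nz by simp
  also have "\<dots> = term_weight x k * chain_sum (map term_weight (y # s)) k"
    using 3(4) by (cases s) (auto simp: term_weight_oplus)
  finally show ?case
    using A disj by (simp add: sum.union_disjoint algebra_simps)
qed auto

lemma sum_Pi_indices_mhs_binom:
  assumes "q \<noteq> []" "0 \<notin> set q"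
  shows "(\<Sum>p\<in>Pi_indices q. 2 ^ length p * mhs_binom n p) = binom_chain_sum n (map term_weight q)"
proof -
  have "(\<Sum>p\<in>Pi_indices q. 2 ^ length p * mhs_binom n p) =
      (\<Sum>p\<in>Pi_indices q. \<Sum>k=1..n.
         binom_quot n k * (2 ^ length p * (term_weight (hd p) k * mhs (k - 1) (tl p))))"
    unfolding mhs_binom_def sum_distrib_left
    by (intro sum.cong refl) (simp add: term_weight_def binom_quot_def mult_ac)
  also have "\<dots> = binom_chain_sum n (map term_weight q)"
    unfolding binom_chain_sum_def sum_Pi_indices[OF assms, symmetric] sum_distrib_left
    by (rule sum.swap)
  finally show ?thesis .
qed

subsection \<open>Identities for the binomial quotient\<close>

lemma binom_quot_0 [simp]: "binom_quot n 0 = 1"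
  by (simp add: binom_quot_def)

text \<open>Follows from absorption in both binomials. Subtracting in the reals keeps it true for
  \<open>k \<ge> n\<close>, where both sides vanish.\<close>

lemma binom_quot_Suc: "(real n + real k + 1) * binom_quot n (Suc k) = (real n - real k) * binom_quot n k"
proof (cases "k < n")
  case True
  have "Suc k * (n choose Suc k) = (n - k) * (n choose k)"
    using binomial_absorb_comp[of n k] binomial_absorption[of k n]
    by (metis Suc_times_binomial_eq binomial_absorption mult.commute)
  then have 1: "(real k + 1) * real (n choose Suc k) = (real n - real k) * real (n choose k)"
    using True by (metis of_nat_mult of_nat_Suc of_nat_diff less_imp_le add.commute)
  have "Suc k * ((n + Suc k) choose Suc k) = (n + Suc k) * ((n + k) choose k)"
    using Suc_times_binomial_eq[of "n + k" k] by (simp add: mult.commute)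
  then have 2: "(real k + 1) * real ((n + Suc k) choose Suc k)
      = (real n + real k + 1) * real ((n + k) choose k)"
    by (subst (asm) of_nat_eq_iff[where 'a = real, symmetric])
       (simp only: of_nat_mult of_nat_Suc of_nat_add add_ac)
  have pos: "real ((n + Suc k) choose Suc k) > 0" "real ((n + k) choose k) > 0"
    by (auto simp del: add_Suc_right binomial_Suc_Suc)
  have "(real n + real k + 1) * (real k + 1) * real (n choose Suc k) * real ((n + k) choose k)
     = (real n - real k) * (real k + 1) * real (n choose k) * real ((n + Suc k) choose Suc k)"
    using 1 2 by algebra
  then have "(real k + 1) * ((real n + real k + 1) * real (n choose Suc k) * real ((n + k) choose k))
     = (real k + 1) * ((real n - real k) * real (n choose k) * real ((n + Suc k) choose Suc k))"
    by (simp add: algebra_simps)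
  then have "(real n + real k + 1) * real (n choose Suc k) * real ((n + k) choose k)
     = (real n - real k) * real (n choose k) * real ((n + Suc k) choose Suc k)"
    by (subst (asm) mult_left_cancel) auto
  then show ?thesis
    using pos unfolding binom_quot_def by (simp only: divide_simps times_divide_eq_right) auto
qed (auto simp: binom_quot_def not_less le_less binomial_eq_0)

lemma binom_quot_Suc_left:
  "(real n + 1)\<^sup>2 * binom_quot n k = ((real n + 1)\<^sup>2 - (real k)\<^sup>2) * binom_quot (Suc n) k"
proof (induction k)
  case (Suc k)
  let ?a = "binom_quot n" and ?b = "binom_quot (Suc n)"
  \<comment> \<open>This positive factor clears the denominators of the recursions in
    \<open>k\<close> at \<open>n\<close> and at \<open>Suc n\<close>.\<close>
  have "(real n + real k + 1) * (real n + real k + 2) * ((real n + 1)\<^sup>2 * ?a (Suc k))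
      = (real n + real k + 2) * (real n - real k) * ((real n + 1)\<^sup>2 * ?a k)"
    using binom_quot_Suc[of n k] by algebra
  also have "\<dots> = (real n + real k + 1) * (real n + real k + 2) *
      (((real n + 1)\<^sup>2 - (real (Suc k))\<^sup>2) * ?b (Suc k))"
    using binom_quot_Suc[of "Suc n" k] Suc.IH unfolding of_nat_Suc by algebra
  finally show ?case
    by (subst (asm) mult_left_cancel) auto
qed simp

lemma binom_quot_diff:
  assumes "n \<ge> 1"
  shows "binom_quot n k - binom_quot (n - 1) k = (real k)\<^sup>2 * binom_quot n k / (real n)\<^sup>2"
proof -
  obtain m where n: "n = Suc m" using assms by (cases n) auto
  show ?thesis
    using binom_quot_Suc_left[of m k] by (simp add: n field_simps)
qed

text \<open>Downward induction from \<open>j = n\<close>, where both sides are 0; the step rests on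
  \<open>2 * (j + 1) + (n - j - 1) = n + j + 1\<close>.\<close>

lemma binom_quot_tail:
  assumes "j \<le> n"
  shows "2 * (\<Sum>k=Suc j..n. real k * binom_quot n k) = (real n - real j) * binom_quot n j"
  using assms
proof (induction j rule: inc_induct)
  case (step j)
  have "(\<Sum>k=Suc j..n. real k * binom_quot n k)
      = real (Suc j) * binom_quot n (Suc j) + (\<Sum>k=Suc (Suc j)..n. real k * binom_quot n k)"
    using step by (intro sum.atLeast_Suc_atMost) simp
  then show ?case
    using binom_quot_Suc[of n j] step.IH unfolding of_nat_Suc by algebra
qed simp

lemma binom_quot_alternating_tail:
  assumes "j \<le> n" "n \<ge> 1"
  shows "2 * real n * (\<Sum>k=Suc j..n. (-1) ^ k * binom_quot n k)
       = - ((-1) ^ j * (real n - real j) * binom_quot n j)"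
  using assms(1)
proof (induction j rule: inc_induct)
  case (step j)
  have "(\<Sum>k=Suc j..n. (-1) ^ k * binom_quot n k)
      = (-1) ^ Suc j * binom_quot n (Suc j) + (\<Sum>k=Suc (Suc j)..n. (-1) ^ k * binom_quot n k)"
    using step by (intro sum.atLeast_Suc_atMost) simp
  \<comment> \<open>Naming the sign leaves a polynomial identity for \<open>algebra\<close>.\<close>
  moreover define e :: real where "e = (-1) ^ j"
  ultimately show ?case
    using binom_quot_Suc[of n j] step.IH
    unfolding of_nat_Suc power_Suc e_def[symmetric] by algebra
qed simp

subsection \<open>Recursions for chain sums\<close>

lemma chain_sum_cong: "f k = g k \<Longrightarrow> chain_sum (f # fs) k = chain_sum (g # fs) k"
  by (cases fs) auto

lemma chain_sum_mult: "chain_sum ((\<lambda>k. u k * f k) # fs) k = u k * chain_sum (f # fs) k"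
  by (cases fs) auto

text \<open>Agreement is asked for \<open>k \<ge> 1\<close> because cancelling powers of
  \<open>k\<close> fails at 0, where division yields 0.\<close>

lemma binom_chain_sum_cong:
  assumes "\<And>k. k \<ge> 1 \<Longrightarrow> f k = g k"
  shows "binom_chain_sum n (f # fs) = binom_chain_sum n (g # fs)"
  unfolding binom_chain_sum_def using assms by (intro sum.cong refl) (simp cong: chain_sum_cong)

lemma binom_chain_sum_diff:
  assumes "n \<ge> 1"
  shows "binom_chain_sum n (f # fs) - binom_chain_sum (n - 1) (f # fs)
       = binom_chain_sum n ((\<lambda>k. (real k)\<^sup>2 * f k) # fs) / (real n)\<^sup>2"
proof -
  obtain m where n: "n = Suc m" using assms by (cases n) auto
  \<comment> \<open>The range extends to \<open>n\<close> since
    \<open>binom_quot (n - 1) n = 0\<close>.\<close>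
  have "binom_chain_sum (n - 1) (f # fs) = (\<Sum>k=1..n. binom_quot (n - 1) k * chain_sum (f # fs) k)"
    unfolding binom_chain_sum_def n by (simp add: binom_quot_def)
  then have "binom_chain_sum n (f # fs) - binom_chain_sum (n - 1) (f # fs)
      = (\<Sum>k=1..n. (binom_quot n k - binom_quot (n - 1) k) * chain_sum (f # fs) k)"
    by (simp add: binom_chain_sum_def sum_subtractf left_diff_distrib)
  also have "\<dots> = binom_chain_sum n ((\<lambda>k. (real k)\<^sup>2 * f k) # fs) / (real n)\<^sup>2"
    unfolding binom_chain_sum_def binom_quot_diff[OF assms] chain_sum_mult
    by (simp add: sum_divide_distrib mult_ac)
  finally show ?thesis .
qed

text \<open>Exchanging the summations isolates the sum over the largest index, to which the tail
  identities apply.\<close>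

lemma binom_chain_sum_Cons_Cons:
  "binom_chain_sum n (f # g # fs) = (\<Sum>j=1..n.
     (f j * binom_quot n j + 2 * (\<Sum>k=Suc j..n. f k * binom_quot n k)) * chain_sum (g # fs) j)"
proof -
  let ?V = "chain_sum (g # fs)"
  let ?A = "\<lambda>k. f k * binom_quot n k"
  have "binom_chain_sum n (f # g # fs)
      = (\<Sum>k=1..n. ?A k * ?V k) + 2 * (\<Sum>k=1..n. \<Sum>j\<in>{1..<k}. ?A k * ?V j)"
    by (simp add: binom_chain_sum_def distrib_left sum.distrib sum_distrib_left mult_ac)
  also have "(\<Sum>k=1..n. \<Sum>j\<in>{1..<k}. ?A k * ?V j) = (\<Sum>j=1..n. \<Sum>k=Suc j..n. ?A k * ?V j)"
    unfolding sum.Sigma[OF finite_atLeastAtMost ballI[OF finite_atLeastLessThan]]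
      sum.Sigma[OF finite_atLeastAtMost ballI[OF finite_atLeastAtMost]]
    by (rule sum.reindex_bij_witness[of _ "\<lambda>(x, y). (y, x)" "\<lambda>(x, y). (y, x)"]) auto
  also have "(\<Sum>k=1..n. ?A k * ?V k) + 2 * \<dots> = (\<Sum>j=1..n. (?A j + 2 * (\<Sum>k=Suc j..n. ?A k)) * ?V j)"
    unfolding distrib_right sum.distrib by (simp add: sum_distrib_left sum_distrib_right mult_ac)
  finally show ?thesis .
qed

lemma binom_chain_sum_strip_id:
  "binom_chain_sum n ((\<lambda>k. real k) # g # fs) = real n * binom_chain_sum n (g # fs)"
proof -
  have "binom_chain_sum n ((\<lambda>k. real k) # g # fs)
      = (\<Sum>j=1..n. real n * (binom_quot n j * chain_sum (g # fs) j))"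
    unfolding binom_chain_sum_Cons_Cons
    by (intro sum.cong refl) (simp add: binom_quot_tail algebra_simps)
  then show ?thesis
    by (simp add: binom_chain_sum_def sum_distrib_left)
qed

text \<open>The factor \<open>(-1) ^ j * j\<close> left by telescoping is absorbed into the next
  weight.\<close>

lemma binom_chain_sum_strip_alternating:
  assumes "n \<ge> 1"
  shows "binom_chain_sum n ((\<lambda>k. (-1) ^ k) # g # fs)
       = binom_chain_sum n ((\<lambda>k. (-1) ^ k * real k * g k) # fs) / real n"
proof -
  have "(-1) ^ j * binom_quot n j + 2 * (\<Sum>k=Suc j..n. (-1) ^ k * binom_quot n k)
      = (-1) ^ j * real j * binom_quot n j / real n" if "j \<le> n" for j
    using binom_quot_alternating_tail[OF that assms] assms by (simp add: field_simps)
  then have "binom_chain_sum n ((\<lambda>k. (-1) ^ k) # g # fs)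
      = (\<Sum>j=1..n. ((-1) ^ j * real j) * binom_quot n j / real n * chain_sum (g # fs) j)"
    unfolding binom_chain_sum_Cons_Cons by (intro sum.cong refl) simp
  also have "\<dots> = binom_chain_sum n ((\<lambda>k. (-1) ^ k * real k * g k) # fs) / real n"
    unfolding binom_chain_sum_def chain_sum_mult[of "\<lambda>k. (-1) ^ k * real k" g]
    by (simp add: sum_divide_distrib mult_ac)
  finally show ?thesis .
qed

lemma binom_chain_sum_alternating:
  assumes "n \<ge> 1"
  shows "binom_chain_sum n [\<lambda>k. (-1) ^ k] = -1"
proof -
  \<comment> \<open>The 2 from \<open>chain_sum [f]\<close> matches the tail identity at
    \<open>j = 0\<close>.\<close>
  have "real n * binom_chain_sum n [\<lambda>k. (-1) ^ k] = 2 * real n * (\<Sum>k=Suc 0..n. (-1) ^ k * binom_quot n k)"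
    by (simp add: binom_chain_sum_def sum_distrib_left mult_ac)
  also have "\<dots> = real n * - 1"
    using binom_quot_alternating_tail[of 0 n] assms by simp
  finally show ?thesis
    using assms by (subst (asm) mult_left_cancel) auto
qed

subsection \<open>Duality\<close>

text \<open>All \<open>n\<close> at once, because stripping an entry of the star sum involves every
  smaller bound.\<close>

definition dual_index :: "int list \<Rightarrow> int list \<Rightarrow> bool" where
  "dual_index s q \<longleftrightarrow> (\<forall>n\<ge>1. mhs_star n s = - binom_chain_sum n (map term_weight q))"

text \<open>Both sides vanish at \<open>n = 0\<close>; the premise equates their increments.\<close>

lemma mhs_star_eq_binom_chain_sum:
  assumes "\<And>j. j \<ge> 1 \<Longrightarrow> term_weight x j * mhs_star j s
      = - (binom_chain_sum j ((\<lambda>k. (real k)\<^sup>2 * f k) # fs) / (real j)\<^sup>2)"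
  shows "mhs_star n (x # s) = - binom_chain_sum n (f # fs)"
proof -
  have "mhs_star n (x # s)
      = (\<Sum>j=1..n. - (binom_chain_sum j (f # fs) - binom_chain_sum (j - 1) (f # fs)))"
    unfolding mhs_star_Cons by (intro sum.cong refl) (simp only: atLeastAtMost_iff assms binom_chain_sum_diff)
  also have "\<dots> = - binom_chain_sum n (f # fs)"
  proof (induction n)
    case 0
    then show ?case by (simp add: binom_chain_sum_def)
  qed simp
  finally show ?thesis .
qed

text \<open>Adding \<open>2 * sgn x\<close> raises the exponent by two and keeps the sign, which
  undoes the factor \<open>k^2\<close> from differencing.\<close>

lemma dual_index_2:
  assumes "dual_index s (x # q)" "x \<noteq> 0"
  shows "dual_index (2 # s) ((x + 2 * sgn x) # q)"
proof -
  have w: "(real k)\<^sup>2 * term_weight (x + 2 * sgn x) k = term_weight x k" if "k \<ge> 1" for k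
  proof -
    have "nat \<bar>x + 2 * sgn x\<bar> = nat \<bar>x\<bar> + 2" "sgn (x + 2 * sgn x) = sgn x"
      using assms(2) by (auto simp: sgn_if)
    then show ?thesis using that by (simp add: term_weight_def power_add power2_eq_square)
  qed
  show ?thesis
    unfolding dual_index_def list.map
  proof (intro allI impI mhs_star_eq_binom_chain_sum)
    fix j :: nat assume "j \<ge> 1"
    then have "mhs_star j s = - binom_chain_sum j (map term_weight (x # q))"
      using assms(1) by (simp add: dual_index_def)
    moreover have "binom_chain_sum j
        ((\<lambda>k. (real k)\<^sup>2 * term_weight (x + 2 * sgn x) k) # map term_weight q)
        = binom_chain_sum j (term_weight x # map term_weight q)"
      by (rule binom_chain_sum_cong) (rule w)
    moreover have "term_weight 2 j = 1 / (real j)\<^sup>2"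
      by (simp add: term_weight_def)
    ultimately show "term_weight 2 j * mhs_star j s = - (binom_chain_sum j
        ((\<lambda>k. (real k)\<^sup>2 * term_weight (x + 2 * sgn x) k) # map term_weight q) / (real j)\<^sup>2)"
      by simp
  qed
qed

lemma dual_index_replicate_2:
  assumes "dual_index s (x # q)" "x \<noteq> 0"
  shows "dual_index (replicate m 2 @ s) ((x + int (2 * m) * sgn x) # q)"
proof (induction m)
  case (Suc m)
  have "x + int (2 * m) * sgn x \<noteq> 0" "sgn (x + int (2 * m) * sgn x) = sgn x"
    using assms(2) by (auto simp: sgn_if)
  with dual_index_2[OF Suc] show ?case by (simp add: algebra_simps)
qed (use assms in simp)

lemma dual_index_1:
  assumes "dual_index s (x # q)"
  shows "dual_index (1 # s) (1 # x # q)"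
  unfolding dual_index_def list.map
proof (intro allI impI mhs_star_eq_binom_chain_sum)
  fix j :: nat assume j: "j \<ge> 1"
  then have s: "mhs_star j s = - binom_chain_sum j (map term_weight (x # q))"
    using assms(1) by (simp add: dual_index_def)
  have w: "(real k)\<^sup>2 * term_weight 1 k = real k" if "k \<ge> 1" for k
    using that by (simp add: term_weight_def power2_eq_square)
  have "binom_chain_sum j ((\<lambda>k. (real k)\<^sup>2 * term_weight 1 k) # map term_weight (x # q))
      = binom_chain_sum j ((\<lambda>k. real k) # map term_weight (x # q))"
    by (rule binom_chain_sum_cong) (rule w)
  moreover have "term_weight 1 j = 1 / real j"
    by (simp add: term_weight_def)
  ultimately show "term_weight 1 j * mhs_star j s = - (binom_chain_sum j
      ((\<lambda>k. (real k)\<^sup>2 * term_weight 1 k) # term_weight x # map term_weight q) / (real j)\<^sup>2)"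
    by (simp add: s binom_chain_sum_strip_id power2_eq_square)
qed

text \<open>Each strip gives \<open>1 / n\<close>. A weight \<open>1 / k\<close> turns
  \<open>(-1) ^ k * k\<close> back into \<open>(-1) ^ k\<close>, so stripping repeats until the
  negative entry absorbs the sign.\<close>

lemma binom_chain_sum_strip_replicate_1:
  assumes "n \<ge> 1" "x > 0"
  shows "binom_chain_sum n ((\<lambda>k. (-1) ^ k) # replicate m (term_weight 1) @ term_weight (- (x + 1)) # fs)
       = binom_chain_sum n (term_weight x # fs) / real n ^ Suc m"
proof (induction m)
  case 0
  have "(-1) ^ k * real k * term_weight (- (x + 1)) k = term_weight x k" if "k \<ge> 1" for k
  proof -
    have "nat \<bar>- (x + 1)\<bar> = Suc (nat \<bar>x\<bar>)" using assms(2) by auto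
    then show ?thesis
      using that assms(2) by (simp add: term_weight_def flip: power_mult_distrib)
  qed
  then have "binom_chain_sum n ((\<lambda>k. (-1) ^ k * real k * term_weight (- (x + 1)) k) # fs)
      = binom_chain_sum n (term_weight x # fs)"
    by (rule binom_chain_sum_cong)
  then show ?case
    using assms(1) by (simp add: binom_chain_sum_strip_alternating)
next
  case (Suc m)
  let ?gs = "replicate m (term_weight 1) @ term_weight (- (x + 1)) # fs"
  have "(-1) ^ k * real k * term_weight 1 k = (-1) ^ k" if "k \<ge> 1" for k
    using that by (simp add: term_weight_def)
  then have "binom_chain_sum n ((\<lambda>k. (-1) ^ k * real k * term_weight 1 k) # ?gs)
      = binom_chain_sum n ((\<lambda>k. (-1) ^ k) # ?gs)"
    by (rule binom_chain_sum_cong)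
  then show ?case
    using assms(1) Suc by (simp add: binom_chain_sum_strip_alternating)
qed

text \<open>The exponent splits as \<open>c = 2 + (c - 2)\<close>: differencing supplies 2, and the
  \<open>c - 2\<close> strips supply the rest.\<close>

lemma dual_index_ge_3:
  assumes "dual_index s (x # q)" "x > 0" "c \<ge> 3"
  shows "dual_index (c # s) (-2 # replicate (nat (c - 3)) 1 @ - (x + 1) # q)"
  unfolding dual_index_def list.map
proof (intro allI impI mhs_star_eq_binom_chain_sum)
  fix j :: nat assume j: "j \<ge> 1"
  let ?gs = "map term_weight (replicate (nat (c - 3)) 1 @ - (x + 1) # q)"
  have s: "mhs_star j s = - binom_chain_sum j (map term_weight (x # q))"
    using assms(1) j by (simp add: dual_index_def)
  have w: "(real k)\<^sup>2 * term_weight (-2) k = (-1) ^ k" if "k \<ge> 1" for k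
    using that by (simp add: term_weight_def)
  have "nat \<bar>c\<bar> = 2 + Suc (nat (c - 3))" using assms(3) by auto
  then have c: "term_weight c j = 1 / (real j ^ Suc (nat (c - 3)) * (real j)\<^sup>2)"
    using assms(3) by (simp add: term_weight_def power2_eq_square mult_ac)
  have "binom_chain_sum j ((\<lambda>k. (real k)\<^sup>2 * term_weight (-2) k) # ?gs)
      = binom_chain_sum j ((\<lambda>k. (-1) ^ k) # ?gs)"
    by (rule binom_chain_sum_cong) (rule w)
  also have "\<dots> = binom_chain_sum j (map term_weight (x # q)) / real j ^ Suc (nat (c - 3))"
    using binom_chain_sum_strip_replicate_1[OF j assms(2)] by simp
  finally show "term_weight c j * mhs_star j s = - (binom_chain_sum j
      ((\<lambda>k. (real k)\<^sup>2 * term_weight (-2) k) # ?gs) / (real j)\<^sup>2)"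
    unfolding s c by simp
qed

text \<open>The base case: \<open>mhs_star j [] = 1\<close> is minus the chain sum of the single
  weight \<open>(-1) ^ k\<close>.\<close>

lemma dual_index_twos:
  assumes "t \<ge> 1"
  shows "dual_index (replicate t 2) [- int (2 * t)]"
proof -
  have w: "(real k)\<^sup>2 * term_weight (-2) k = (-1) ^ k" if "k \<ge> 1" for k
    using that by (simp add: term_weight_def)
  have "dual_index [2] [-2]"
    unfolding dual_index_def list.map
  proof (intro allI impI mhs_star_eq_binom_chain_sum)
    fix j :: nat assume "j \<ge> 1"
    then show "term_weight 2 j * mhs_star j []
        = - (binom_chain_sum j [\<lambda>k. (real k)\<^sup>2 * term_weight (-2) k] / (real j)\<^sup>2)"
      by (simp add: w binom_chain_sum_alternating term_weight_def cong: binom_chain_sum_cong)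
  qed
  \<comment> \<open>One of the \<open>t\<close> twos is already in the base
    \<open>[2]\<close>.\<close>
  from dual_index_replicate_2[OF this, of "t - 1"] assms show ?thesis
    by (cases t) (simp_all add: replicate_append_same algebra_simps)
qed

text \<open>Stated for an arbitrary list \<open>js\<close> since blocks are prepended, whereas
  \<open>[1..<Suc r]\<close> grows at its end.\<close>

lemma dual_index_blocks:
  assumes "t \<ge> 1" "\<And>j. j \<in> set js \<Longrightarrow> c j \<ge> 3"
  shows "dual_index
    (concat (map (\<lambda>j. replicate (b j) 2 @ [c j] @ replicate (a j) 2 @ [1]) js) @ replicate t 2)
    (concat (map (\<lambda>j. [- int (2 * b j + 2)] @ replicate (nat (c j - 3)) 1 @ [- int (2 * a j + 2)]) js)
      @ [- int (2 * t)])"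
  using assms(2)
proof (induction js)
  case Nil
  then show ?case using dual_index_twos[OF assms(1)] by simp
next
  case (Cons j js)
  let ?S = "concat (map (\<lambda>j. replicate (b j) 2 @ [c j] @ replicate (a j) 2 @ [1]) js) @ replicate t 2"
  let ?Q = "concat (map (\<lambda>j. [- int (2 * b j + 2)] @ replicate (nat (c j - 3)) 1
      @ [- int (2 * a j + 2)]) js) @ [- int (2 * t)]"
  obtain x q where Q: "?Q = x # q" by (cases ?Q) auto
  have "dual_index ?S ?Q" using Cons by simp
  then have "dual_index (1 # ?S) (1 # ?Q)"
    unfolding Q by (rule dual_index_1)
  from dual_index_replicate_2[OF this, of "a j"]
  have "dual_index (replicate (a j) 2 @ 1 # ?S) ((1 + int (2 * a j)) # ?Q)" by simp
  from dual_index_ge_3[OF this, of "c j"] Cons.prems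
  have "dual_index (c j # replicate (a j) 2 @ 1 # ?S)
      (-2 # replicate (nat (c j - 3)) 1 @ - (1 + int (2 * a j) + 1) # ?Q)" by simp
  from dual_index_replicate_2[OF this, of "b j"]
  show ?case by (simp add: algebra_simps)
qed

theorem theorem6p1:
  fixes t n :: nat and a b :: "nat \<Rightarrow> nat" and c :: "nat \<Rightarrow> int"
  assumes "t \<ge> 1" and "\<And>j. j \<ge> 1 \<Longrightarrow> c j \<ge> 3" and "n \<ge> 1"
  shows "(\<forall>r\<ge>1. mhs_star n (star_blocks a b c r @ replicate t 2) =
           - (\<Sum>p\<in>Pi_indices (Pi_blocks a b c r @ [- int (2 * t)]). 2 ^ length p * mhs_binom n p)) \<and>
         (\<forall>r. mhs_star n (replicate (a 0) 2 @ [1] @ star_blocks a b c r @ replicate t 2) =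
           - (\<Sum>p\<in>Pi_indices ([int (2 * a 0 + 1)] @ Pi_blocks a b c r @ [- int (2 * t)]).
                2 ^ length p * mhs_binom n p))"
proof -
  have dual: "dual_index (star_blocks a b c r @ replicate t 2) (Pi_blocks a b c r @ [- int (2 * t)])"
    for r
    unfolding star_blocks_def Pi_blocks_def using assms by (intro dual_index_blocks) auto
  \<comment> \<open>The entry 1 puts a 1 in front of the dual, and the \<open>a 0\<close> twos raise
    it to \<open>2 * a 0 + 1\<close>.\<close>
  have dual1: "dual_index (replicate (a 0) 2 @ [1] @ star_blocks a b c r @ replicate t 2)
      ([int (2 * a 0 + 1)] @ Pi_blocks a b c r @ [- int (2 * t)])" for r
  proof -
    obtain x q where Q: "Pi_blocks a b c r @ [- int (2 * t)] = x # q"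
      by (cases "Pi_blocks a b c r @ [- int (2 * t)]") auto
    show ?thesis
      using dual_index_replicate_2[OF dual_index_1[OF dual[of r, unfolded Q]], of "a 0"]
      unfolding Q by (simp add: algebra_simps)
  qed
  \<comment> \<open>The last entry is nonzero because \<open>t \<ge> 1\<close>.\<close>
  have nz: "0 \<notin> set (Pi_blocks a b c r @ [- int (2 * t)])" for r
    using assms(1) by (auto simp: Pi_blocks_def)
  show ?thesis
    using dual dual1 nz assms(3) by (simp add: dual_index_def sum_Pi_indices_mhs_binom)
qed

end
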